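(* Let $\sigma$ be a contiguous pattern and let $k$ be an integer greater than all letters of $\sigma$. Let $g(x)=\sum_{n\ge0} g_n\frac{x^n}{n!}$ and $h(x)=\sum_{n\ge 0}h_n\frac{x^n}{n!}$ be the exponential generating functions of the permutations avoiding $k$-$\sigma$ and of the permutations avoiding $k$-$\sigma$-$k$, respectively. Then for all $n\ge 0$ $$h_{n+1}=\sum_{i=0}^n\binom{n}{i}g_i\,g_{n-i},$$ and $$h(x)=1+\int g(x)^2\,dx .$$
   Context: $\mathcal{S}_n$ is the set of permutations of $\{1,\dots,n\}$, written as words. A (partially ordered generalized) pattern is a nonempty word $p_1p_2\dots p_m$ of positive integers (repetitions allowed) with a dash written between some of the consecutive letters; it is contiguous if it has no dashes. An occurrence of it in a permutation $\pi=a_1\dots a_n$ is a subsequence $a_{j_1}\dots a_{j_m}$, $j_1<\dots<j_m$, such that (a) $p_s>p_t$ implies $a_{j_s}>a_{j_t}$ for all $s,t$ (no condition when $p_s=p_t$), and (b) $j_{s+1}=j_s+1$ whenever $p_s$ and $p_{s+1}$ are not separated by a dash. $\pi$ avoids the pattern if it has no occurrence. $k$-$\sigma$ is the letter $k$, a dash, then $\sigma$; $k$-$\sigma$-$k$ is $k$-$\sigma$ followed by a dash and the letter $k$. The exponential generating function of the permutations avoiding $P$ is $\sum_{n\ge0}c_n\frac{x^n}{n!}$ with $c_n$ the number of permutations in $\mathcal{S}_n$ avoiding $P$ (including $n=0$, the empty permutation). The formal integral of a power series is $\int\sum_{n\ge0} f_nx^n\,dx=\sum_{n\ge0} f_n\frac{x^{n+1}}{n+1}$.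 *)

theory Defs
  imports "HOL-Computational_Algebra.Formal_Power_Series" "HOL-Combinatorics.Multiset_Permutations"
begin

text \<open>
  Letters are indexed from 0; an index \<open>s\<close> in \<open>dashes\<close> stands for a dash written
  between the letters \<open>s\<close> and \<open>s + 1\<close>.
\<close>

datatype pattern = Pattern (letters: "nat list") (dashes: "nat set")

definition is_pattern :: "pattern \<Rightarrow> bool" where
  "is_pattern p \<longleftrightarrow>
     letters p \<noteq> [] \<and> (\<forall>a\<in>set (letters p). a > 0) \<and> (\<forall>s\<in>dashes p. Suc s < length (letters p))"

definition contiguous :: "pattern \<Rightarrow> bool" where
  "contiguous p \<longleftrightarrow> dashes p = {}"

definition single_letter :: "nat \<Rightarrow> pattern" where
  "single_letter k = Pattern [k] {}"

text \<open>
  \<open>dash_join p q\<close> is \<open>p\<close>, a dash, then \<open>q\<close>. The new dash follows the last letter of \<open>p\<close>,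
  and the dashes of \<open>q\<close> are shifted by the length of \<open>p\<close>.
\<close>

definition dash_join :: "pattern \<Rightarrow> pattern \<Rightarrow> pattern" where
  "dash_join p q =
     Pattern (letters p @ letters q)
       (dashes p \<union> {length (letters p) - 1} \<union> (\<lambda>s. length (letters p) + s) ` dashes q)"

text \<open>
  \<open>js\<close> lists the (0-based) positions in \<open>\<pi>\<close> of the letters of an occurrence. Equal letters
  of the pattern impose no order condition.
\<close>

definition occurrence :: "pattern \<Rightarrow> nat list \<Rightarrow> nat list \<Rightarrow> bool" where
  "occurrence p \<pi> js \<longleftrightarrow>
     length js = length (letters p) \<and> sorted_wrt (<) js \<and> (\<forall>j\<in>set js. j < length \<pi>) \<and>
     (\<forall>s < length (letters p). \<forall>t < length (letters p).
        letters p ! s > letters p ! t \<longrightarrow> \<pi> ! (js ! s) > \<pi> ! (js ! t)) \<and>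
     (\<forall>s. Suc s < length (letters p) \<and> s \<notin> dashes p \<longrightarrow> js ! Suc s = Suc (js ! s))"

definition avoids :: "nat list \<Rightarrow> pattern \<Rightarrow> bool" where
  "avoids \<pi> p \<longleftrightarrow> \<not> (\<exists>js. occurrence p \<pi> js)"

definition num_avoiding :: "pattern \<Rightarrow> nat \<Rightarrow> nat" where
  "num_avoiding p n = card {\<pi> \<in> permutations_of_set {1..n}. avoids \<pi> p}"

definition egf_avoiding :: "pattern \<Rightarrow> real fps" where
  "egf_avoiding p = Abs_fps (\<lambda>n. of_nat (num_avoiding p n) / fact n)"

definition k_dash :: "nat \<Rightarrow> pattern \<Rightarrow> pattern" where
  "k_dash k \<sigma> = dash_join (single_letter k) \<sigma>"

definition k_dash_k :: "nat \<Rightarrow> pattern \<Rightarrow> pattern" where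
  "k_dash_k k \<sigma> = dash_join (k_dash k \<sigma>) (single_letter k)"

end

theory Submission
  imports Defs
begin

text \<open>
  Cut a permutation at its maximum, \<open>\<pi> = xs m ys\<close>. All letters of \<open>\<sigma>\<close> are smaller than \<open>k\<close>,
  so a window playing the role of \<open>\<sigma>\<close> cannot contain \<open>m\<close> and lies in \<open>xs\<close> or in \<open>ys\<close>, while
  \<open>m\<close> itself can always serve as the letter \<open>k\<close> on the other side. Hence \<open>\<pi>\<close> avoids
  \<open>k\<close>-\<open>\<sigma>\<close>-\<open>k\<close> iff \<open>xs\<close> avoids \<open>k\<close>-\<open>\<sigma>\<close> and \<open>ys\<close> avoids \<open>\<sigma>\<close>-\<open>k\<close>.
  In the same way \<open>\<pi>\<close> avoids \<open>k\<close>-\<open>\<sigma>\<close> iff \<open>xs\<close> avoids \<open>k\<close>-\<open>\<sigma>\<close> and \<open>ys\<close> avoids \<open>\<sigma>\<close>, and \<open>\<pi>\<close> avoids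
  \<open>\<sigma>\<close>-\<open>k\<close> iff \<open>xs\<close> avoids \<open>\<sigma>\<close> and \<open>ys\<close> avoids \<open>\<sigma>\<close>-\<open>k\<close>. The two resulting recurrences are mirror
  images of each other, so \<open>k\<close>-\<open>\<sigma>\<close> and \<open>\<sigma>\<close>-\<open>k\<close> are avoided by equally many permutations.
\<close>

section \<open>Relabelling letters by increasing maps\<close>

lemma occurrence_map:
  assumes "strict_mono_on (set \<pi>) f"
  shows "occurrence p (map f \<pi>) js \<longleftrightarrow> occurrence p \<pi> js"
proof -
  have "map f \<pi> ! (js ! s) > map f \<pi> ! (js ! t) \<longleftrightarrow> \<pi> ! (js ! s) > \<pi> ! (js ! t)"
    if "\<forall>j\<in>set js. j < length \<pi>" "s < length js" "t < length js" for s t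
    using that strict_mono_on_less[OF assms] by (simp add: nth_mem)
  then show ?thesis
    unfolding occurrence_def by (auto simp del: nth_map)
qed

lemma avoids_map:
  assumes "strict_mono_on (set \<pi>) f"
  shows "avoids (map f \<pi>) p \<longleftrightarrow> avoids \<pi> p"
  unfolding avoids_def using occurrence_map[OF assms] by simp

text \<open>Avoidance depends only on the relative order of letters, so the increasing bijection
  from \<open>{1..card A}\<close> onto \<open>A\<close> carries avoiding permutations to avoiding
  permutations.\<close>

lemma card_avoiding_permutations_of_set:
  assumes "finite (A :: nat set)"
  shows "card {\<pi> \<in> permutations_of_set A. avoids \<pi> p} = num_avoiding p (card A)"
proof -
  \<comment> \<open>Letters start at 1 but list indices at 0, hence \<open>i - 1\<close>:
    \<open>f i\<close> is the \<open>i\<close>-th smallest element of \<open>A\<close>.\<close>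
  define f where "f = (\<lambda>i. sorted_list_of_set A ! (i - 1))"
  have mono: "strict_mono_on {1..card A} f"
    unfolding f_def using assms strict_sorted_list_of_set[of A]
    by (intro strict_mono_onI) (auto simp: sorted_wrt_iff_nth_less)
  have "f ` {1..card A} \<subseteq> A"
  proof (intro image_subsetI)
    fix i assume "i \<in> {1..card A}"
    then have "f i \<in> set (sorted_list_of_set A)"
      unfolding f_def by (intro nth_mem) auto
    then show "f i \<in> A"
      using assms by simp
  qed
  moreover have "card (f ` {1..card A}) = card A"
    using card_image[OF strict_mono_on_imp_inj_on[OF mono]] by simp
  ultimately have img: "f ` {1..card A} = A"
    using assms card_subset_eq by metis
  have "permutations_of_set A = map f ` permutations_of_set {1..card A}"
    using permutations_of_set_image_inj[OF strict_mono_on_imp_inj_on[OF mono]] img by simp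
  moreover have "avoids (map f \<pi>) p \<longleftrightarrow> avoids \<pi> p"
    if "\<pi> \<in> permutations_of_set {1..card A}" for \<pi>
    using that mono by (intro avoids_map) (simp add: permutations_of_set_def)
  ultimately have "{\<pi> \<in> permutations_of_set A. avoids \<pi> p} =
      map f ` {\<pi> \<in> permutations_of_set {1..card A}. avoids \<pi> p}"
    by auto
  moreover have "inj_on (map f) {\<pi> \<in> permutations_of_set {1..card A}. avoids \<pi> p}"
    using strict_mono_on_imp_inj_on[OF mono]
    by (intro inj_on_mapI) (auto simp: permutations_of_set_def elim!: inj_on_subset)
  ultimately show ?thesis
    by (simp add: card_image num_avoiding_def)
qed

section \<open>The recurrence obtained from a cut at the maximum\<close>

text \<open>A permutation is determined by the set \<open>B\<close> of letters before its maximum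
  together with the arrangements of \<open>B\<close> and of its complement. Keeping
  \<open>r\<close>, \<open>p\<close> and \<open>q\<close> abstract lets all three patterns share
  this count.\<close>

lemma num_avoiding_Suc:
  assumes split: "\<And>xs ys m. \<forall>x\<in>set xs \<union> set ys. x < m \<Longrightarrow>
      avoids (xs @ m # ys) r \<longleftrightarrow> avoids xs p \<and> avoids ys q"
  shows "num_avoiding r (Suc n) = (\<Sum>i=0..n. (n choose i) * num_avoiding p i * num_avoiding q (n - i))"
proof -
  define av where "av = (\<lambda>p A. {\<pi> \<in> permutations_of_set A. avoids \<pi> p})"
  define D where "D = (SIGMA B:Pow {1..n}. av p B \<times> av q ({1..n} - B))"
  define F where "F = (\<lambda>(B :: nat set, xs, ys). xs @ Suc n # ys)"
  have D: "set xs = B \<and> set ys = {1..n} - B \<and> B \<subseteq> {1..n} \<and> distinct xs \<and> distinct ys \<and>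
      avoids xs p \<and> avoids ys q" if "(B, xs, ys) \<in> D" for B xs ys
    using that by (auto simp: D_def av_def permutations_of_set_def)
  have "inj_on F D"
  proof (rule inj_onI)
    fix z z' assume z: "z \<in> D" "z' \<in> D" "F z = F z'"
    obtain B xs ys B' xs' ys' where eq: "z = (B, xs, ys)" "z' = (B', xs', ys')"
      by (metis prod.exhaust)
    \<comment> \<open>The maximum occurs once in the word, so its place recovers both halves, and
      the left half recovers \<open>B\<close>.\<close>
    have "Suc n \<notin> set xs" "Suc n \<notin> set ys" "Suc n \<notin> set xs'"
      using D[of B xs ys] D[of B' xs' ys'] z eq by auto
    then have "xs = xs' \<and> ys = ys'"
      using z(3) append_Cons_eq_iff[of "Suc n" xs ys xs' ys'] by (simp add: F_def eq)
    then show "z = z'"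
      using D[of B xs ys] D[of B' xs' ys'] z eq by auto
  qed
  moreover have "F ` D = av r {1..Suc n}"
  proof (intro equalityI subsetI)
    fix \<pi> assume "\<pi> \<in> F ` D"
    then obtain B xs ys where z: "(B, xs, ys) \<in> D" "\<pi> = xs @ Suc n # ys"
      by (auto simp: F_def)
    have "set xs \<union> set ys = {1..n}"
      using D[OF z(1)] by auto
    then have "\<forall>x\<in>set xs \<union> set ys. x < Suc n"
      by simp
    then show "\<pi> \<in> av r {1..Suc n}"
      using D[OF z(1)] split[of xs ys "Suc n"] z(2) by (auto simp: av_def permutations_of_set_def)
  next
    fix \<pi> assume "\<pi> \<in> av r {1..Suc n}"
    then have \<pi>: "set \<pi> = {1..Suc n}" "distinct \<pi>" "avoids \<pi> r"
      by (auto simp: av_def permutations_of_set_def)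
    then have "Suc n \<in> set \<pi>"
      by simp
    then obtain xs ys where eq: "\<pi> = xs @ Suc n # ys"
      by (meson split_list)
    have "x \<le> n" if "x \<in> set xs \<union> set ys" for x
    proof -
      have "x \<le> Suc n" "x \<noteq> Suc n"
        using \<pi> that eq by auto
      then show ?thesis
        by simp
    qed
    moreover have "set xs \<union> set ys = set \<pi> - {Suc n}"
      using \<pi>(2) eq by auto
    then have "set xs \<union> set ys = {1..n}"
      by (simp add: \<pi>(1) atLeastAtMostSuc_conv)
    moreover have "set xs \<inter> set ys = {}"
      using \<pi> eq by auto
    ultimately have "(set xs, xs, ys) \<in> D"
      using \<pi> eq split[of xs ys "Suc n"]
      by (auto simp: D_def av_def permutations_of_set_def less_Suc_eq_le)
    then show "\<pi> \<in> F ` D"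
      by (force simp: F_def eq)
  qed
  ultimately have "num_avoiding r (Suc n) = card D"
    by (metis av_def bij_betw_def bij_betw_same_card num_avoiding_def)
  also have "\<dots> = (\<Sum>B\<in>Pow {1..n}. card (av p B \<times> av q ({1..n} - B)))"
    unfolding D_def by (intro card_SigmaI) (auto simp: av_def)
  also have "\<dots> = (\<Sum>B\<in>Pow {1..n}. num_avoiding p (card B) * num_avoiding q (n - card B))"
    by (intro sum.cong refl)
      (auto simp: av_def card_cartesian_product card_avoiding_permutations_of_set card_Diff_subset
        finite_subset)
  \<comment> \<open>The summand depends on \<open>B\<close> only through its size, so grouping by
    size produces the binomial coefficients.\<close>
  also have "\<dots> = (\<Sum>i=0..n. \<Sum>B\<in>{B \<in> Pow {1..n}. card B = i}.
      num_avoiding p (card B) * num_avoiding q (n - card B))"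
    by (intro sum.group[symmetric]) (auto dest: card_mono[rotated])
  also have "\<dots> = (\<Sum>i=0..n. (n choose i) * num_avoiding p i * num_avoiding q (n - i))"
    using n_subsets[of "{1..n}"] by (intro sum.cong refl) (simp add: Pow_def)
  finally show ?thesis .
qed

section \<open>Occurrences as windows, and adding a letter by a dash\<close>

definition order_matches :: "pattern \<Rightarrow> nat list \<Rightarrow> bool" where
  "order_matches p w \<longleftrightarrow> length w = length (letters p) \<and>
     (\<forall>s < length w. \<forall>t < length w. letters p ! s > letters p ! t \<longrightarrow> w ! s > w ! t)"

text \<open>Without dashes each position is the successor of the previous one, so the positions form
  an interval and the occurrence is a factor \<open>w\<close> of the word.\<close>

lemma occurrence_contiguous:
  assumes "contiguous p"
  shows "occurrence p \<pi> js \<longleftrightarrow>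
    (\<exists>u w v. \<pi> = u @ w @ v \<and> order_matches p w \<and> js = [length u..<length u + length w])"
    (is "?L \<longleftrightarrow> ?R")
proof
  assume occ: ?L
  define l where "l = length (letters p)"
  show ?R
  proof (cases "l = 0")
    \<comment> \<open>Since \<open>is_pattern\<close> is not assumed, the list of letters may be
      empty; \<open>js ! 0\<close> would then be meaningless, and the empty window serves.\<close>
    case True
    then show ?thesis
      using occ by (intro exI[of _ "[]"] exI[of _ "[]"] exI[of _ \<pi>])
        (simp add: occurrence_def order_matches_def l_def)
  next
    case False
    define i where "i = js ! 0"
    have len: "length js = l"
      using occ by (simp add: occurrence_def l_def)
    have nth: "js ! s = i + s" if "s < l" for s
      using that
      by (induction s) (use occ assms in \<open>auto simp: i_def occurrence_def contiguous_def l_def\<close>)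
    have js: "js = [i..<i + l]"
      by (intro nth_equalityI) (auto simp: len nth)
    have "i + l - 1 \<in> set js"
      using False by (simp add: js)
    then have le: "i + l \<le> length \<pi>"
      using occ False by (fastforce simp: occurrence_def)
    define w where "w = take l (drop i \<pi>)"
    have "\<pi> = take i \<pi> @ w @ drop (i + l) \<pi>"
      by (metis append_take_drop_id drop_drop w_def add.commute)
    moreover have "order_matches p w"
      using occ le nth by (simp add: order_matches_def occurrence_def w_def l_def)
    moreover have "js = [length (take i \<pi>)..<length (take i \<pi>) + length w]"
      using le js by (simp add: w_def)
    ultimately show ?thesis
      by blast
  qed
next
  assume ?R
  then show ?L
    using assms by (auto simp: occurrence_def order_matches_def contiguous_def nth_append)
qed

text \<open>As no letter of \<open>p\<close> exceeds \<open>k\<close>, the new letter adds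
  comparisons in one direction only, and none with letters equal to \<open>k\<close>. The dash
  leaves only the order of positions, for which \<open>j < hd js\<close> suffices because
  \<open>js\<close> increases.\<close>

lemma occurrence_letter_dash:
  assumes "letters p \<noteq> []" and "\<forall>a\<in>set (letters p). a \<le> k"
  shows "occurrence (dash_join (single_letter k) p) \<pi> is \<longleftrightarrow>
    (\<exists>j js. is = j # js \<and> occurrence p \<pi> js \<and> j < hd js \<and>
      (\<forall>s < length (letters p). letters p ! s < k \<longrightarrow> \<pi> ! (js ! s) < \<pi> ! j))"
proof (cases "is")
  case Nil
  then show ?thesis
    by (simp add: occurrence_def dash_join_def single_letter_def)
next
  case (Cons j js)
  have le: "\<not> k < letters p ! s" if "s < length (letters p)" for s
    using assms that by (simp add: leD)
  have hd: "(\<forall>x\<in>set js. j < x) \<and> sorted_wrt (<) js \<longleftrightarrow> j < hd js \<and> sorted_wrt (<) js"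
    if "length js = length (letters p)"
    using that assms(1) by (cases js) auto
  have j: "j < length \<pi>" if "\<forall>x\<in>set js. x < length \<pi>" "j < hd js" "length js = length (letters p)"
    using that assms(1) by (cases js) auto
  \<comment> \<open>Index 0 carries the new dash; the dashes of \<open>p\<close> move up by
    one.\<close>
  have dashes: "(\<forall>s. Suc s < Suc (length (letters p)) \<and> s \<notin> insert 0 (Suc ` dashes p) \<longrightarrow>
       (j # js) ! Suc s = Suc ((j # js) ! s)) \<longleftrightarrow>
     (\<forall>s. Suc s < length (letters p) \<and> s \<notin> dashes p \<longrightarrow> js ! Suc s = Suc (js ! s))"
    (is "?A \<longleftrightarrow> ?B")
  proof
    assume A: ?A
    show ?B
    proof (intro allI impI)
      fix s assume "Suc s < length (letters p) \<and> s \<notin> dashes p"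
      then show "js ! Suc s = Suc (js ! s)"
        using A[rule_format, of "Suc s"] by auto
    qed
  next
    assume B: ?B
    show ?A
    proof (intro allI impI)
      fix s assume "Suc s < Suc (length (letters p)) \<and> s \<notin> insert 0 (Suc ` dashes p)"
      then show "(j # js) ! Suc s = Suc ((j # js) ! s)"
        using B by (cases s) auto
    qed
  qed
  have "occurrence (dash_join (single_letter k) p) \<pi> is \<longleftrightarrow>
    length js = length (letters p) \<and> ((\<forall>x\<in>set js. j < x) \<and> sorted_wrt (<) js) \<and>
    j < length \<pi> \<and> (\<forall>x\<in>set js. x < length \<pi>) \<and>
    (\<forall>s < length (letters p). letters p ! s < k \<longrightarrow> \<pi> ! (js ! s) < \<pi> ! j) \<and>
    (\<forall>s < length (letters p). \<forall>t < length (letters p).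
        letters p ! s > letters p ! t \<longrightarrow> \<pi> ! (js ! s) > \<pi> ! (js ! t)) \<and>
    (\<forall>s. Suc s < Suc (length (letters p)) \<and> s \<notin> insert 0 (Suc ` dashes p) \<longrightarrow>
       (j # js) ! Suc s = Suc ((j # js) ! s))"
    using le
    by (auto simp: Cons occurrence_def dash_join_def single_letter_def All_less_Suc2)
  then show ?thesis
    unfolding dashes using hd j by (auto simp: Cons occurrence_def)
qed

text \<open>The bound is weak so that \<open>p\<close> may contain \<open>k\<close>, as happens when
  the final letter is added to \<open>k_dash k \<sigma>\<close>. Here \<open>j\<close> is the
  largest position, so \<open>j < length \<pi>\<close> has to be stated separately.\<close>

lemma occurrence_dash_letter:
  assumes "is_pattern p" and "\<forall>a\<in>set (letters p). a \<le> k"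
  shows "occurrence (dash_join p (single_letter k)) \<pi> is \<longleftrightarrow>
    (\<exists>js j. is = js @ [j] \<and> occurrence p \<pi> js \<and> last js < j \<and> j < length \<pi> \<and>
      (\<forall>s < length (letters p). letters p ! s < k \<longrightarrow> \<pi> ! (js ! s) < \<pi> ! j))"
proof (cases "is" rule: rev_cases)
  case Nil
  then show ?thesis
    by (simp add: occurrence_def dash_join_def single_letter_def)
next
  case (snoc js j)
  have ne: "letters p \<noteq> []"
    using assms by (simp add: is_pattern_def)
  have le: "\<not> k < letters p ! s" if "s < length (letters p)" for s
    using assms that by (simp add: leD)
  have last: "(\<forall>x\<in>set js. x < j) \<and> sorted_wrt (<) js \<longleftrightarrow> last js < j \<and> sorted_wrt (<) js"
    if "length js = length (letters p)"
    using that ne by (cases js rule: rev_cases) (auto simp: sorted_wrt_append)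
  \<comment> \<open>The new dash sits at the last index of \<open>p\<close>; excluding it removes
    exactly the adjacency between \<open>last js\<close> and \<open>j\<close>.\<close>
  have dashes: "(\<forall>s. Suc s < Suc (length (letters p)) \<and>
       s \<notin> insert (length (letters p) - 1) (dashes p) \<longrightarrow>
       (js @ [j]) ! Suc s = Suc ((js @ [j]) ! s)) \<longleftrightarrow>
     (\<forall>s. Suc s < length (letters p) \<and> s \<notin> dashes p \<longrightarrow> js ! Suc s = Suc (js ! s))"
    (is "?A \<longleftrightarrow> ?B") if len: "length js = length (letters p)"
  proof
    assume A: ?A
    show ?B
    proof (intro allI impI)
      fix s assume "Suc s < length (letters p) \<and> s \<notin> dashes p"
      then show "js ! Suc s = Suc (js ! s)"
        using A[rule_format, of s] len by (auto simp: nth_append)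
    qed
  next
    assume B: ?B
    show ?A
    proof (intro allI impI)
      fix s assume s: "Suc s < Suc (length (letters p)) \<and>
        s \<notin> insert (length (letters p) - 1) (dashes p)"
      then have "Suc s < length (letters p)"
        by auto
      then show "(js @ [j]) ! Suc s = Suc ((js @ [j]) ! s)"
        using B s len by (auto simp: nth_append)
    qed
  qed
  have "occurrence (dash_join p (single_letter k)) \<pi> is \<longleftrightarrow>
    length js = length (letters p) \<and> ((\<forall>x\<in>set js. x < j) \<and> sorted_wrt (<) js) \<and>
    j < length \<pi> \<and> (\<forall>x\<in>set js. x < length \<pi>) \<and>
    (\<forall>s < length (letters p). letters p ! s < k \<longrightarrow> \<pi> ! (js ! s) < \<pi> ! j) \<and>
    (\<forall>s < length (letters p). \<forall>t < length (letters p).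
        letters p ! s > letters p ! t \<longrightarrow> \<pi> ! (js ! s) > \<pi> ! (js ! t)) \<and>
    (\<forall>s. Suc s < Suc (length (letters p)) \<and>
       s \<notin> insert (length (letters p) - 1) (dashes p) \<longrightarrow>
       (js @ [j]) ! Suc s = Suc ((js @ [j]) ! s))"
    using le
    by (cases "length js = length (letters p)")
      (auto simp: snoc occurrence_def dash_join_def single_letter_def All_less_Suc nth_append
         sorted_wrt_append)
  then show ?thesis
    using last dashes by (auto simp: snoc occurrence_def)
qed

lemma bex_nth: "(\<exists>x\<in>set u. P x) \<longleftrightarrow> (\<exists>j < length u. P (u ! j))"
  by (metis in_set_conv_nth)

lemma avoids_contiguous_iff:
  assumes "contiguous p"
  shows "avoids \<pi> p \<longleftrightarrow> \<not> (\<exists>u w v. \<pi> = u @ w @ v \<and> order_matches p w)"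
  unfolding avoids_def occurrence_contiguous[OF assms] by blast

section \<open>Avoidance of the three dashed patterns in terms of factorizations\<close>

context
  fixes \<sigma> :: pattern and k :: nat
  assumes pattern: "is_pattern \<sigma>" and contiguous: "contiguous \<sigma>"
    and less_k: "\<forall>a\<in>set (letters \<sigma>). a < k"
begin

lemma order_matches_nonempty: "order_matches \<sigma> w \<Longrightarrow> w \<noteq> []"
  using pattern by (auto simp: order_matches_def is_pattern_def)

lemma letter_less_k: "s < length (letters \<sigma>) \<Longrightarrow> letters \<sigma> ! s < k"
  using less_k by simp

text \<open>All letters of \<open>\<sigma>\<close> are below \<open>k\<close>, so the guard always
  holds, and the listed positions run through exactly the letters of \<open>w\<close>.\<close>

lemma window_less_iff:
  assumes "order_matches \<sigma> w"
  shows "(\<forall>s < length (letters \<sigma>). letters \<sigma> ! s < k \<longrightarrow>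
      (u @ w @ v) ! ([length u..<length u + length w] ! s) < x) \<longleftrightarrow> (\<forall>y\<in>set w. y < x)"
  using assms letter_less_k by (auto simp: order_matches_def all_set_conv_all_nth nth_append)

text \<open>The window is nonempty, so its first position is \<open>length u\<close>, and a position
  \<open>j\<close> before it points into \<open>u\<close>.\<close>

lemma occurrence_k_dash:
  "occurrence (k_dash k \<sigma>) \<pi> is \<longleftrightarrow> (\<exists>u w v j. \<pi> = u @ w @ v \<and> order_matches \<sigma> w \<and>
     is = j # [length u..<length u + length w] \<and> j < length u \<and> (\<forall>y\<in>set w. y < u ! j))"
proof -
  have "occurrence (k_dash k \<sigma>) \<pi> is \<longleftrightarrow> (\<exists>u w v j. \<pi> = u @ w @ v \<and> order_matches \<sigma> w \<and>
     is = j # [length u..<length u + length w] \<and> j < hd [length u..<length u + length w] \<and>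
     (\<forall>y\<in>set w. y < (u @ w @ v) ! j))"
    unfolding k_dash_def
    by (subst occurrence_letter_dash)
      (use pattern less_k window_less_iff in
        \<open>auto simp: is_pattern_def occurrence_contiguous[OF contiguous] less_imp_le, blast+\<close>)
  moreover have "order_matches \<sigma> w \<and> is = j # [length u..<length u + length w] \<and>
      j < hd [length u..<length u + length w] \<and> (\<forall>y\<in>set w. y < (u @ w @ v) ! j) \<longleftrightarrow>
    order_matches \<sigma> w \<and> is = j # [length u..<length u + length w] \<and>
      j < length u \<and> (\<forall>y\<in>set w. y < u ! j)" for u w v :: "nat list" and j
    using order_matches_nonempty[of w] by (auto simp: nth_append)
  ultimately show ?thesis
    by simp
qed

text \<open>This and its two analogues below trade positions for factorizations
  \<open>u @ w @ v\<close>, so that the cut at the maximum becomes a question about list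
  concatenation.\<close>

lemma avoids_k_dash_iff:
  "avoids \<pi> (k_dash k \<sigma>) \<longleftrightarrow> \<not> (\<exists>u w v. \<pi> = u @ w @ v \<and> order_matches \<sigma> w \<and>
     (\<exists>x\<in>set u. \<forall>y\<in>set w. y < x))"
  unfolding avoids_def occurrence_k_dash bex_nth by blast

lemma last_window:
  assumes "order_matches \<sigma> w"
  shows "last [length u..<length u + length w] < j \<longleftrightarrow> length u + length w \<le> j"
  using order_matches_nonempty[OF assms] by (cases w) auto

lemma bex_nth_behind:
  "(\<exists>j. length u + length w \<le> j \<and> j < length (u @ w @ v) \<and> P ((u @ w @ v) ! j)) \<longleftrightarrow>
    (\<exists>x\<in>set v. P x)"
proof
  assume "\<exists>j. length u + length w \<le> j \<and> j < length (u @ w @ v) \<and> P ((u @ w @ v) ! j)"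
  then obtain j where "length u + length w \<le> j" "j < length (u @ w @ v)" "P ((u @ w @ v) ! j)"
    by blast
  moreover from this have "(u @ w @ v) ! j = v ! (j - length u - length w)"
    by (simp add: nth_append less_diff_conv2)
  ultimately show "\<exists>x\<in>set v. P x"
    by (intro bexI[of _ "v ! (j - length u - length w)"]) auto
next
  assume "\<exists>x\<in>set v. P x"
  then obtain i where "i < length v" "P (v ! i)"
    by (auto simp: bex_nth)
  then show "\<exists>j. length u + length w \<le> j \<and> j < length (u @ w @ v) \<and> P ((u @ w @ v) ! j)"
    by (intro exI[of _ "length u + length w + i"]) (auto simp: nth_append)
qed

lemma avoids_dash_k_iff:
  "avoids \<pi> (dash_join \<sigma> (single_letter k)) \<longleftrightarrow>
     \<not> (\<exists>u w v. \<pi> = u @ w @ v \<and> order_matches \<sigma> w \<and> (\<exists>x\<in>set v. \<forall>y\<in>set w. y < x))"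
proof -
  have "(\<exists>is. occurrence (dash_join \<sigma> (single_letter k)) \<pi> is) \<longleftrightarrow>
    (\<exists>u w v. \<pi> = u @ w @ v \<and> order_matches \<sigma> w \<and>
      (\<exists>j. last [length u..<length u + length w] < j \<and> j < length (u @ w @ v) \<and>
        (\<forall>s < length (letters \<sigma>). letters \<sigma> ! s < k \<longrightarrow>
          (u @ w @ v) ! ([length u..<length u + length w] ! s) < (u @ w @ v) ! j)))"
    using less_k
    by (subst occurrence_dash_letter[OF pattern])
      (auto simp: occurrence_contiguous[OF contiguous] less_imp_le, blast+)
  also have "\<dots> \<longleftrightarrow> (\<exists>u w v. \<pi> = u @ w @ v \<and> order_matches \<sigma> w \<and>
      (\<exists>j. length u + length w \<le> j \<and> j < length (u @ w @ v) \<and> (\<forall>y\<in>set w. y < (u @ w @ v) ! j)))"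
    by (simp only: window_less_iff last_window cong: conj_cong)
  finally show ?thesis
    by (simp only: avoids_def bex_nth_behind[where P = "\<lambda>x. \<forall>y\<in>set w. y < x" for w])
qed

text \<open>The pattern is read as \<open>k_dash k \<sigma>\<close> with a final letter added. The
  two outer letters are equal and hence not compared with each other, so the conditions on
  \<open>u\<close> and \<open>v\<close> are independent.\<close>

lemma avoids_k_dash_k_iff:
  "avoids \<pi> (k_dash_k k \<sigma>) \<longleftrightarrow> \<not> (\<exists>u w v. \<pi> = u @ w @ v \<and> order_matches \<sigma> w \<and>
     (\<exists>x\<in>set u. \<forall>y\<in>set w. y < x) \<and> (\<exists>x\<in>set v. \<forall>y\<in>set w. y < x))"
proof -
  have letters: "letters (k_dash k \<sigma>) = k # letters \<sigma>"
    by (simp add: k_dash_def dash_join_def single_letter_def)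
  have "is_pattern (k_dash k \<sigma>)"
    using pattern less_k by (cases \<sigma>)
      (auto simp: k_dash_def dash_join_def single_letter_def is_pattern_def neq_Nil_conv)
  moreover have "\<forall>a\<in>set (letters (k_dash k \<sigma>)). a \<le> k"
    using less_k by (auto simp: letters)
  \<comment> \<open>The leading letter is \<open>k\<close> itself, so its guard \<open>k < k\<close>
    fails and its condition disappears; the letters of \<open>\<sigma>\<close> then correspond to
    the entries \<open>js ! Suc s\<close>.\<close>
  ultimately have "(\<exists>is. occurrence (k_dash_k k \<sigma>) \<pi> is) \<longleftrightarrow>
    (\<exists>js j. occurrence (k_dash k \<sigma>) \<pi> js \<and> last js < j \<and> j < length \<pi> \<and>
      (\<forall>s < length (letters \<sigma>). letters \<sigma> ! s < k \<longrightarrow> \<pi> ! (js ! Suc s) < \<pi> ! j))"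
    unfolding k_dash_k_def by (subst occurrence_dash_letter) (auto simp: letters All_less_Suc2)
  also have "\<dots> \<longleftrightarrow>
    (\<exists>u w v. \<pi> = u @ w @ v \<and> order_matches \<sigma> w \<and> (\<exists>x\<in>set u. \<forall>y\<in>set w. y < x) \<and>
      (\<exists>j. last [length u..<length u + length w] < j \<and> j < length (u @ w @ v) \<and>
        (\<forall>s < length (letters \<sigma>). letters \<sigma> ! s < k \<longrightarrow>
          (u @ w @ v) ! ([length u..<length u + length w] ! s) < (u @ w @ v) ! j)))"
    (is "?L \<longleftrightarrow> ?R")
  proof
    assume ?L
    then obtain js j where js: "occurrence (k_dash k \<sigma>) \<pi> js" "last js < j" "j < length \<pi>"
      "\<forall>s < length (letters \<sigma>). letters \<sigma> ! s < k \<longrightarrow> \<pi> ! (js ! Suc s) < \<pi> ! j"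
      by blast
    obtain u w v i where u: "\<pi> = u @ w @ v" "order_matches \<sigma> w"
      "js = i # [length u..<length u + length w]" "i < length u" "\<forall>y\<in>set w. y < u ! i"
      using js(1) unfolding occurrence_k_dash by blast
    have "\<exists>x\<in>set u. \<forall>y\<in>set w. y < x"
      using u(4,5) nth_mem by blast
    moreover have "last [length u..<length u + length w] < j"
      using js(2) order_matches_nonempty[OF u(2)] by (simp add: u(3))
    moreover have "js ! Suc s = [length u..<length u + length w] ! s" for s
      by (simp add: u(3))
    ultimately show ?R
      using js(3,4) u(2) unfolding u(1) by metis
  next
    assume ?R
    then obtain u w v x j where u: "\<pi> = u @ w @ v" "order_matches \<sigma> w"
      "x \<in> set u" "\<forall>y\<in>set w. y < x"
      "last [length u..<length u + length w] < j" "j < length (u @ w @ v)"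
      "\<forall>s < length (letters \<sigma>). letters \<sigma> ! s < k \<longrightarrow>
        (u @ w @ v) ! ([length u..<length u + length w] ! s) < (u @ w @ v) ! j"
      by (elim exE conjE bexE) (rule that)
    obtain i where i: "i < length u" "\<forall>y\<in>set w. y < u ! i"
      using u(3,4) by (auto simp: in_set_conv_nth)
    define js where "js = i # [length u..<length u + length w]"
    have "occurrence (k_dash k \<sigma>) \<pi> js"
      unfolding occurrence_k_dash js_def using u(1,2) i by blast
    moreover have "last js < j"
      using u(5) order_matches_nonempty[OF u(2)] by (simp add: js_def)
    moreover have "js ! Suc s = [length u..<length u + length w] ! s" for s
      by (simp add: js_def)
    ultimately show ?L
      using u(6,7) unfolding u(1) by metis
  qed
  also have "\<dots> \<longleftrightarrow> (\<exists>u w v. \<pi> = u @ w @ v \<and> order_matches \<sigma> w \<and>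
      (\<exists>x\<in>set u. \<forall>y\<in>set w. y < x) \<and>
      (\<exists>j. length u + length w \<le> j \<and> j < length (u @ w @ v) \<and> (\<forall>y\<in>set w. y < (u @ w @ v) ! j)))"
    by (simp only: window_less_iff last_window cong: conj_cong)
  finally show ?thesis
    by (simp only: avoids_def bex_nth_behind[where P = "\<lambda>x. \<forall>y\<in>set w. y < x" for w])
qed

section \<open>Cutting words at their maximum\<close>

text \<open>A factor is connected, so one that misses the marked \<open>m\<close> cannot straddle
  it.\<close>

lemma window_avoiding_letter:
  assumes "xs @ m # ys = u @ w @ v" and "m \<notin> set w" and "w \<noteq> []"
  obtains v' where "xs = u @ w @ v'" "v = v' @ m # ys"
    | u' where "ys = u' @ w @ v" "u = xs @ m # u'"
proof -
  consider us where "xs = u @ us" "us @ m # ys = w @ v" | us where "xs @ us = u" "m # ys = us @ w @ v"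
    using assms(1) unfolding append_eq_append_conv2 by blast
  then show ?thesis
  proof cases
    case 1
    then consider v' where "us = w @ v'" "v' @ m # ys = v" | us' where "us @ us' = w" "m # ys = us' @ v"
      unfolding append_eq_append_conv2 by blast
    then show ?thesis
    proof cases
      case (2 us')
      \<comment> \<open>A nonempty \<open>us'\<close> would start with \<open>m\<close> and lie in
        \<open>w\<close>; hence the window ends just before \<open>m\<close>.\<close>
      then have "us' = []"
        using assms(2) by (cases us') auto
      then show ?thesis
        using 1 2 that(1)[of "[]"] by simp
    qed (use 1 that(1) in auto)
  next
    case (2 us)
    \<comment> \<open>If \<open>us\<close> were empty, the nonempty \<open>w\<close> would start
      with \<open>m\<close>; hence \<open>m\<close> is the first letter of
      \<open>us\<close>.\<close>
    then show ?thesis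
      using assms(2,3) that(2) by (cases us; cases w) auto
  qed
qed

lemma avoids_k_dash_split:
  assumes "\<forall>x\<in>set xs \<union> set ys. x < m"
  shows "avoids (xs @ m # ys) (k_dash k \<sigma>) \<longleftrightarrow> avoids xs (k_dash k \<sigma>) \<and> avoids ys \<sigma>"
    (is "?L \<longleftrightarrow> ?R")
proof
  assume L: ?L
  have "avoids xs (k_dash k \<sigma>)"
    unfolding avoids_k_dash_iff
  proof clarify
    fix u w v x assume "xs = u @ w @ v" "order_matches \<sigma> w" "x \<in> set u" "\<forall>y\<in>set w. y < x"
    moreover from this have "xs @ m # ys = u @ w @ (v @ m # ys)"
      by simp
    ultimately show False
      using L unfolding avoids_k_dash_iff by blast
  qed
  moreover have "avoids ys \<sigma>"
    unfolding avoids_contiguous_iff[OF contiguous]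
  proof clarify
    fix u w v assume "ys = u @ w @ v" "order_matches \<sigma> w"
    \<comment> \<open>The maximum \<open>m\<close> plays the letter \<open>k\<close> in front of any
      window of \<open>ys\<close>.\<close>
    moreover from this have "xs @ m # ys = (xs @ m # u) @ w @ v" "m \<in> set (xs @ m # u)" "\<forall>y\<in>set w. y < m"
      using assms by auto
    ultimately show False
      using L unfolding avoids_k_dash_iff by blast
  qed
  ultimately show ?R ..
next
  assume R: ?R
  show ?L
    unfolding avoids_k_dash_iff
  proof clarify
    fix u w v x assume w: "xs @ m # ys = u @ w @ v" "order_matches \<sigma> w" "x \<in> set u" "\<forall>y\<in>set w. y < x"
    have "x \<in> set (xs @ m # ys)"
      using w(1,3) by simp
    then have "x \<le> m"
      using assms by (auto intro: less_imp_le)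
    \<comment> \<open>Every letter of \<open>w\<close> is below \<open>x\<close>, and
      \<open>x \<le> m\<close>.\<close>
    then have "m \<notin> set w"
      using w(4) by auto
    from w(1) this order_matches_nonempty[OF w(2)] show False
    proof (cases rule: window_avoiding_letter)
      \<comment> \<open>Here \<open>u\<close> lies inside \<open>xs\<close>, so the large letter
        \<open>x\<close> does too and \<open>xs\<close> contains the whole pattern. In the other
        case \<open>x\<close> may lie outside \<open>ys\<close>, but a bare match of
        \<open>\<sigma>\<close> in \<open>ys\<close> is already forbidden.\<close>
      case 1
      then show False
        using R w unfolding avoids_k_dash_iff by blast
    next
      case 2
      then show False
        using R w unfolding avoids_contiguous_iff[OF contiguous] by blast
    qed
  qed
qed

text \<open>Mirror image of \<open>avoids_k_dash_split\<close>: now \<open>m\<close> serves as the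
  large letter behind any window of \<open>xs\<close>.\<close>

lemma avoids_dash_k_split:
  assumes "\<forall>x\<in>set xs \<union> set ys. x < m"
  shows "avoids (xs @ m # ys) (dash_join \<sigma> (single_letter k)) \<longleftrightarrow>
    avoids xs \<sigma> \<and> avoids ys (dash_join \<sigma> (single_letter k))"
    (is "?L \<longleftrightarrow> ?R")
proof
  assume L: ?L
  have "avoids ys (dash_join \<sigma> (single_letter k))"
    unfolding avoids_dash_k_iff
  proof clarify
    fix u w v x assume "ys = u @ w @ v" "order_matches \<sigma> w" "x \<in> set v" "\<forall>y\<in>set w. y < x"
    moreover from this have "xs @ m # ys = (xs @ m # u) @ w @ v"
      by simp
    ultimately show False
      using L unfolding avoids_dash_k_iff by blast
  qed
  moreover have "avoids xs \<sigma>"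
    unfolding avoids_contiguous_iff[OF contiguous]
  proof clarify
    fix u w v assume "xs = u @ w @ v" "order_matches \<sigma> w"
    moreover from this have "xs @ m # ys = u @ w @ (v @ m # ys)" "m \<in> set (v @ m # ys)" "\<forall>y\<in>set w. y < m"
      using assms by auto
    ultimately show False
      using L unfolding avoids_dash_k_iff by blast
  qed
  ultimately show ?R
    by simp
next
  assume R: ?R
  show ?L
    unfolding avoids_dash_k_iff
  proof clarify
    fix u w v x assume w: "xs @ m # ys = u @ w @ v" "order_matches \<sigma> w" "x \<in> set v" "\<forall>y\<in>set w. y < x"
    have "x \<in> set (xs @ m # ys)"
      using w(1,3) by simp
    then have "x \<le> m"
      using assms by (auto intro: less_imp_le)
    then have "m \<notin> set w"
      using w(4) by auto
    from w(1) this order_matches_nonempty[OF w(2)] show False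
    proof (cases rule: window_avoiding_letter)
      case 1
      then show False
        using R w unfolding avoids_contiguous_iff[OF contiguous] by blast
    next
      case 2
      then show False
        using R w unfolding avoids_dash_k_iff by blast
    qed
  qed
qed

text \<open>For a window in \<open>xs\<close>, \<open>m\<close> supplies the letter behind it,
  leaving only the one in front to be found in \<open>xs\<close>; for a window in \<open>ys\<close>
  the roles are exchanged.\<close>

lemma avoids_k_dash_k_split:
  assumes "\<forall>x\<in>set xs \<union> set ys. x < m"
  shows "avoids (xs @ m # ys) (k_dash_k k \<sigma>) \<longleftrightarrow>
    avoids xs (k_dash k \<sigma>) \<and> avoids ys (dash_join \<sigma> (single_letter k))"
    (is "?L \<longleftrightarrow> ?R")
proof
  assume L: ?L
  have "avoids xs (k_dash k \<sigma>)"
    unfolding avoids_k_dash_iff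
  proof clarify
    fix u w v x assume "xs = u @ w @ v" "order_matches \<sigma> w" "x \<in> set u" "\<forall>y\<in>set w. y < x"
    moreover from this have "xs @ m # ys = u @ w @ (v @ m # ys)" "m \<in> set (v @ m # ys)" "\<forall>y\<in>set w. y < m"
      using assms by auto
    ultimately show False
      using L unfolding avoids_k_dash_k_iff by blast
  qed
  moreover have "avoids ys (dash_join \<sigma> (single_letter k))"
    unfolding avoids_dash_k_iff
  proof clarify
    fix u w v x assume "ys = u @ w @ v" "order_matches \<sigma> w" "x \<in> set v" "\<forall>y\<in>set w. y < x"
    moreover from this have "xs @ m # ys = (xs @ m # u) @ w @ v" "m \<in> set (xs @ m # u)" "\<forall>y\<in>set w. y < m"
      using assms by auto
    ultimately show False
      using L unfolding avoids_k_dash_k_iff by blast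
  qed
  ultimately show ?R ..
next
  assume R: ?R
  show ?L
    unfolding avoids_k_dash_k_iff
  proof clarify
    fix u w v x x' assume w: "xs @ m # ys = u @ w @ v" "order_matches \<sigma> w"
      "x \<in> set u" "\<forall>y\<in>set w. y < x" "x' \<in> set v" "\<forall>y\<in>set w. y < x'"
    have "x \<in> set (xs @ m # ys)"
      using w(1,3) by simp
    then have "x \<le> m"
      using assms by (auto intro: less_imp_le)
    then have "m \<notin> set w"
      using w(4) by auto
    from w(1) this order_matches_nonempty[OF w(2)] show False
    proof (cases rule: window_avoiding_letter)
      case 1
      then show False
        using R w unfolding avoids_k_dash_iff by blast
    next
      case 2
      then show False
        using R w unfolding avoids_dash_k_iff by blast
    qed
  qed
qed

section \<open>Equal counts on both sides, and the recurrence\<close>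

text \<open>Reversing words would also reverse \<open>\<sigma>\<close>, so the equality comes from
  strong induction on the two recurrences.\<close>

lemma num_avoiding_dash_k:
  "num_avoiding (dash_join \<sigma> (single_letter k)) n = num_avoiding (k_dash k \<sigma>) n"
proof (induction n rule: less_induct)
  case (less n)
  show ?case
  proof (cases n)
    case 0
    have "avoids [] (dash_join \<sigma> (single_letter k))" "avoids [] (k_dash k \<sigma>)"
      by (simp_all add: avoids_dash_k_iff avoids_k_dash_iff)
    then show ?thesis
      by (simp add: 0 num_avoiding_def cong: conj_cong)
  next
    case (Suc l)
    have "num_avoiding (dash_join \<sigma> (single_letter k)) (Suc l) =
        (\<Sum>i=0..l. (l choose i) * num_avoiding \<sigma> i * num_avoiding (dash_join \<sigma> (single_letter k)) (l - i))"
      by (intro num_avoiding_Suc avoids_dash_k_split)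
    also have "\<dots> = (\<Sum>i=0..l. (l choose i) * num_avoiding \<sigma> i * num_avoiding (k_dash k \<sigma>) (l - i))"
      using less by (simp add: Suc)
    also have "\<dots> = (\<Sum>i=0..l. (l choose i) * num_avoiding (k_dash k \<sigma>) i * num_avoiding \<sigma> (l - i))"
      \<comment> \<open>Substituting \<open>l - i\<close> for \<open>i\<close> swaps the two counts
        and preserves the binomial coefficient.\<close>
      by (subst sum.atLeastAtMost_rev)
        (auto intro!: sum.cong simp: binomial_symmetric[symmetric])
    also have "\<dots> = num_avoiding (k_dash k \<sigma>) (Suc l)"
      by (intro num_avoiding_Suc[symmetric] avoids_k_dash_split)
    finally show ?thesis
      by (simp add: Suc)
  qed
qed

lemma num_avoiding_k_dash_k_0: "num_avoiding (k_dash_k k \<sigma>) 0 = 1"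
proof -
  have "{\<pi> \<in> permutations_of_set {1..0::nat}. avoids \<pi> (k_dash_k k \<sigma>)} = {[]}"
    by (auto simp: avoids_k_dash_k_iff)
  then show ?thesis
    by (simp add: num_avoiding_def)
qed

lemma num_avoiding_k_dash_k_Suc:
  "num_avoiding (k_dash_k k \<sigma>) (Suc n) =
    (\<Sum>i=0..n. (n choose i) * num_avoiding (k_dash k \<sigma>) i * num_avoiding (k_dash k \<sigma>) (n - i))"
  using num_avoiding_Suc[OF avoids_k_dash_k_split] by (simp add: num_avoiding_dash_k)

end

section \<open>From the recurrence to the generating function\<close>

theorem corollary12:
  fixes \<sigma> :: pattern and k :: nat
  assumes "is_pattern \<sigma>" and "contiguous \<sigma>" and "\<forall>a\<in>set (letters \<sigma>). a < k"
  shows "(\<forall>n. num_avoiding (k_dash_k k \<sigma>) (n + 1) =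
            (\<Sum>i=0..n. (n choose i) * num_avoiding (k_dash k \<sigma>) i * num_avoiding (k_dash k \<sigma>) (n - i))) \<and>
         egf_avoiding (k_dash_k k \<sigma>) = 1 + fps_integral0 ((egf_avoiding (k_dash k \<sigma>))\<^sup>2)"
proof (intro conjI allI fps_ext)
  fix n
  show "num_avoiding (k_dash_k k \<sigma>) (n + 1) =
      (\<Sum>i=0..n. (n choose i) * num_avoiding (k_dash k \<sigma>) i * num_avoiding (k_dash k \<sigma>) (n - i))"
    unfolding Suc_eq_plus1[symmetric] by (rule num_avoiding_k_dash_k_Suc[OF assms])
  show "fps_nth (egf_avoiding (k_dash_k k \<sigma>)) n = fps_nth (1 + fps_integral0 ((egf_avoiding (k_dash k \<sigma>))\<^sup>2)) n"
  proof (cases n)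
    \<comment> \<open>The integral has constant term 0, so the summand 1 accounts for the empty
      permutation.\<close>
    case 0
    then show ?thesis
      using num_avoiding_k_dash_k_0[OF assms] by (simp add: egf_avoiding_def fps_integral_def)
  next
    case (Suc l)
    let ?g = "num_avoiding (k_dash k \<sigma>)"
    have "real (num_avoiding (k_dash_k k \<sigma>) (Suc l)) / fact (Suc l) =
        (\<Sum>i=0..l. real (l choose i) * real (?g i) * real (?g (l - i)) / fact (Suc l))"
      unfolding num_avoiding_k_dash_k_Suc[OF assms] of_nat_sum of_nat_mult sum_divide_distrib ..
    \<comment> \<open>Dividing the binomial coefficient by \<open>fact (Suc l)\<close> leaves the
      factorials of \<open>i\<close> and \<open>l - i\<close>, which belong to the product of the
      series, and a factor \<open>1 / Suc l\<close>, which belongs to the integral.\<close>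
    also have "\<dots> = (\<Sum>i=0..l. real (?g i) / fact i * (real (?g (l - i)) / fact (l - i)) / real (Suc l))"
      by (intro sum.cong refl) (simp add: binomial_fact fact_Suc del: of_nat_Suc)
    also have "\<dots> = (\<Sum>i=0..l. real (?g i) / fact i * (real (?g (l - i)) / fact (l - i))) / real (Suc l)"
      by (rule sum_divide_distrib[symmetric])
    finally show ?thesis
      by (simp add: Suc egf_avoiding_def fps_integral_def fps_mult_nth power2_eq_square
          divide_inverse mult.commute del: of_nat_Suc fact_Suc)
  qed
qed

end
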